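(* Let $n\geq 1$ and $m\geq n$ be integers, and let the processing times $t_{ij}$ ($i\in\{1,\dots,n\}$, $j\in\{1,\dots,m\}$) be i.i.d. random variables drawn from a continuous MHR distribution $\mathcal D$ on $[0,\infty)$. Then $$\mathbb E[\mathrm{VCG}(\mathbf t)]\leq 2\left(1+\frac{n\ln n}{m}\right)\mathbb E[\mathrm{OPT}(\mathbf t)].$$
   Context: There are $n$ machines and $m\ge n$ tasks; $t_{ij}\ge 0$ is the processing time of task $j$ on machine $i$, and $\mathbf t=(t_{ij})$. The VCG allocation assigns each task $j$ to a machine $i$ with $t_{ij}=\min_{i'}t_{i'j}$, ties (which have probability zero for continuous distributions) being broken uniformly at random. With $\alpha_{ij}\in\{0,1\}$ indicating whether VCG assigns task $j$ to machine $i$, $\mathrm{VCG}(\mathbf t)=\max_i\sum_{j=1}^m\alpha_{ij}t_{ij}$ is its makespan. $\mathrm{OPT}(\mathbf t)$ is the minimum, over all assignments $a:\{1,\dots,m\}\to\{1,\dots,n\}$ of tasks to machines, of the makespan $\max_i\sum_{j:a(j)=i}t_{ij}$. A continuous distribution with pdf $f$ and cdf $F$ is MHR (monotone hazard rate) if its hazard rate $h(x)=\frac{f(x)}{1-F(x)}$ is weakly increasing (on the set where $F(x)<1$). *)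

theory Defs
  imports "HOL-Probability.Probability"
begin

definition hazard_rate :: "real measure \<Rightarrow> (real \<Rightarrow> real) \<Rightarrow> real \<Rightarrow> real" where
  "hazard_rate D f x = f x / (1 - cdf D x)"

text \<open>
  A density is determined only up to a null set, so the condition is that some
  version of it makes the hazard rate weakly increasing.
\<close>

definition MHR :: "real measure \<Rightarrow> bool" where
  "MHR D \<longleftrightarrow> (\<exists>f \<in> borel_measurable borel. (\<forall>x. 0 \<le> f x) \<and>
     D = density lborel (\<lambda>x. ennreal (f x)) \<and>
     mono_on {x. cdf D x < 1} (hazard_rate D f))"

text \<open>
  Machines are \<open>{..<n}\<close>, tasks are \<open>{..<m}\<close>, and \<open>t i j\<close> is the processing time of task
  \<open>j\<close> on machine \<open>i\<close>. An assignment maps each task to a machine.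
\<close>

definition makespan :: "nat \<Rightarrow> nat \<Rightarrow> (nat \<Rightarrow> nat \<Rightarrow> real) \<Rightarrow> (nat \<Rightarrow> nat) \<Rightarrow> real" where
  "makespan n m t a = (MAX i\<in>{..<n}. \<Sum>j\<in>{j. j < m \<and> a j = i}. t i j)"

definition OPT :: "nat \<Rightarrow> nat \<Rightarrow> (nat \<Rightarrow> nat \<Rightarrow> real) \<Rightarrow> real" where
  "OPT n m t = (MIN a\<in>{..<m} \<rightarrow>\<^sub>E {..<n}. makespan n m t a)"

definition fastest_machines :: "nat \<Rightarrow> (nat \<Rightarrow> nat \<Rightarrow> real) \<Rightarrow> nat \<Rightarrow> nat set" where
  "fastest_machines n t j = {i. i < n \<and> t i j = (MIN i'\<in>{..<n}. t i' j)}"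

definition VCG_assignment :: "nat \<Rightarrow> nat \<Rightarrow> (nat \<Rightarrow> nat \<Rightarrow> real) \<Rightarrow> (nat \<Rightarrow> nat) pmf" where
  "VCG_assignment n m t =
     Pi_pmf {..<m} undefined (\<lambda>j. pmf_of_set (fastest_machines n t j))"

text \<open>
  The makespan of VCG on \<open>t\<close>, averaged over the tie-breaking. If no column of \<open>t\<close> has a tie
  for its minimum, the assignment is deterministic and this is simply its makespan.
\<close>

definition VCG :: "nat \<Rightarrow> nat \<Rightarrow> (nat \<Rightarrow> nat \<Rightarrow> real) \<Rightarrow> real" where
  "VCG n m t = measure_pmf.expectation (VCG_assignment n m t) (makespan n m t)"

end

theory Submission
  imports Defs
begin

text \<open>
  Let \<open>Y j\<close> be the smallest processing time of task \<open>j\<close>, with mean \<open>\<mu>\<close>. Averaging over the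
  machines gives \<open>OPT \<ge> (\<Sum>j<m. Y j) / n\<close>, so \<open>E OPT \<ge> m * \<mu> / n\<close>.

  VCG throws task \<open>j\<close>, with weight \<open>Y j\<close>, at a uniformly random machine. A monotone hazard
  rate makes the survival function submultiplicative, \<open>G (x + y) \<le> G x * G y\<close> (``new better than
  used'', NBU); this passes to \<open>G ^ n\<close>, the survival function of \<open>Y j\<close>, and gives
  \<open>E (exp (Y j / (2 * \<mu>))) \<le> 2\<close>. By independence of the tasks and symmetry of the machines, the
  load \<open>S\<close> of a machine then satisfies \<open>E (exp (S / (2 * \<mu>))) \<le> (1 + 1 / n) ^ m \<le> exp (m / n)\<close>.
  Bounding the maximum by the logarithm of the sum of exponentials over the \<open>n\<close> machines,
  \<open>E VCG \<le> 2 * \<mu> * (ln n + m / n) \<le> 2 * (1 + n * ln n / m) * E OPT\<close>.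
\<close>

section \<open>Survival functions under a monotone hazard rate\<close>

text \<open>A Gronwall inequality for a function not assumed differentiable. The one-step bound is
  iterated over \<open>N\<close> equal subintervals of \<open>[a, b]\<close>, and
  \<open>(1 + c * (b - a) / N) ^ N\<close> tends to the exponential.\<close>

lemma exp_lower_growth:
  fixes G :: "real \<Rightarrow> real"
  assumes "a \<le> b" "0 \<le> c" "\<And>s. 0 \<le> G s"
    and step: "\<And>s t. a \<le> s \<Longrightarrow> s \<le> t \<Longrightarrow> t \<le> b \<Longrightarrow> G t * (1 + c * (t - s)) \<le> G s"
  shows "G b * exp (c * (b - a)) \<le> G a"
proof -
  have "G b * (1 + c * (b - a) / real N) ^ N \<le> G a" if N: "N > 0" for N :: nat
  proof -
    define d where "d = (b - a) / real N"
    have d: "0 \<le> d" "a + real N * d = b" using N assms(1) by (auto simp: d_def)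
    have "G (a + real k * d) * (1 + c * d) ^ k \<le> G a" if "k \<le> N" for k
      using that
    proof (induction k)
      case (Suc k)
      have "a + real (Suc k) * d \<le> a + real N * d"
        using Suc.prems d(1) by (intro add_left_mono mult_right_mono) auto
      then have "G (a + real (Suc k) * d) * (1 + c * d) \<le> G (a + real k * d)"
        using step[of "a + real k * d" "a + real (Suc k) * d"] d by (simp add: algebra_simps)
      then have "G (a + real (Suc k) * d) * (1 + c * d) * (1 + c * d) ^ k
          \<le> G (a + real k * d) * (1 + c * d) ^ k"
        using d(1) assms(2) by (intro mult_right_mono) auto
      then show ?case using Suc by (simp add: mult_ac)
    qed simp
    from this[of N] d(2) show ?thesis by (simp add: d_def)
  qed
  then have "\<forall>\<^sub>F N in sequentially. G b * (1 + c * (b - a) / real N) ^ N \<le> G a"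
    by (rule eventually_mono[OF eventually_gt_at_top[of "0::nat"]])
  moreover have "(\<lambda>N. G b * (1 + c * (b - a) / real N) ^ N) \<longlonglongrightarrow> G b * exp (c * (b - a))"
    by (intro tendsto_intros tendsto_exp_limit_sequentially)
  ultimately show ?thesis by (metis tendsto_upperbound sequentially_bot)
qed

text \<open>The same subdivision with the inequality reversed. Multiplying the induction hypothesis
  by \<open>1 - c * d\<close> requires this factor to be nonnegative, so only \<open>N\<close> with
  \<open>c * (b - a) \<le> real N\<close> are used; all large \<open>N\<close> qualify.\<close>

lemma exp_upper_decay:
  fixes G :: "real \<Rightarrow> real"
  assumes "a \<le> b"
    and step: "\<And>s t. a \<le> s \<Longrightarrow> s \<le> t \<Longrightarrow> t \<le> b \<Longrightarrow> G s * (1 - c * (t - s)) \<le> G t"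
  shows "G a * exp (- c * (b - a)) \<le> G b"
proof -
  have "G a * (1 + (- c * (b - a)) / real N) ^ N \<le> G b"
    if N: "N > 0" "c * (b - a) \<le> real N" for N :: nat
  proof -
    define d where "d = (b - a) / real N"
    have d: "0 \<le> d" "a + real N * d = b" "0 \<le> 1 - c * d"
      using N assms(1) by (auto simp: d_def field_simps)
    have "G a * (1 - c * d) ^ k \<le> G (a + real k * d)" if "k \<le> N" for k
      using that
    proof (induction k)
      case (Suc k)
      have "a + real (Suc k) * d \<le> a + real N * d"
        using Suc.prems d(1) by (intro add_left_mono mult_right_mono) auto
      then have "G (a + real k * d) * (1 - c * d) \<le> G (a + real (Suc k) * d)"
        using step[of "a + real k * d" "a + real (Suc k) * d"] d by (simp add: algebra_simps)
      moreover have "G a * (1 - c * d) ^ k * (1 - c * d) \<le> G (a + real k * d) * (1 - c * d)"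
        using Suc d(3) by (intro mult_right_mono) auto
      ultimately show ?case by (simp add: mult_ac)
    qed simp
    from this[of N] d(2) show ?thesis by (simp add: d_def)
  qed
  moreover have "\<forall>\<^sub>F N in sequentially. N > 0 \<and> c * (b - a) \<le> real N"
    by (intro eventually_conj eventually_gt_at_top)
      (meson eventually_at_top_linorder real_arch_simple of_nat_le_iff order_trans)
  ultimately have "\<forall>\<^sub>F N in sequentially. G a * (1 + (- c * (b - a)) / real N) ^ N \<le> G b"
    by (auto elim: eventually_mono)
  moreover have "(\<lambda>N. G a * (1 + (- c * (b - a)) / real N) ^ N) \<longlonglongrightarrow> G a * exp (- c * (b - a))"
    by (intro tendsto_intros tendsto_exp_limit_sequentially)
  ultimately show ?thesis by (metis tendsto_upperbound sequentially_bot)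
qed

text \<open>Where the survival function \<open>G\<close> is positive, the density is
  \<open>h * G\<close>. Monotonicity of \<open>h\<close> therefore gives one-step bounds on the
  decrease of \<open>G\<close>, which the two exponential comparisons above turn into bounds over
  whole intervals.\<close>

lemma
  assumes "prob_space D" "MHR D" "AE x in D. 0 \<le> x"
  shows MHR_survival_0: "measure D {0<..} = 1"
    and MHR_survival_add_le: "0 \<le> x \<Longrightarrow> 0 \<le> y \<Longrightarrow>
      measure D {x + y<..} \<le> measure D {x<..} * measure D {y<..}"
proof -
  interpret prob_space D by fact
  obtain f where [measurable]: "f \<in> borel_measurable borel" and f0: "\<And>x. 0 \<le> f x"
    and D: "D = density lborel (\<lambda>x. ennreal (f x))"
    and mono: "mono_on {x. cdf D x < 1} (hazard_rate D f)"
    using assms(2) by (auto simp: MHR_def)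
  have [simp]: "sets D = sets borel" "space D = UNIV" by (simp_all add: D)
  define G where "G x = measure D {x<..}" for x
  define h where "h = hazard_rate D f"
  have "UNIV - {..x} = {x<..}" for x :: real by auto
  then have cdf: "cdf D x = 1 - G x" for x
    using prob_compl[of "{..x}"] by (simp add: cdf_def G_def)
  have h: "f u = h u * G u" if "0 < G u" for u
    using that by (simp add: h_def hazard_rate_def cdf)
  have h0: "0 \<le> h u" if "0 < G u" for u
    using that f0 by (simp add: h_def hazard_rate_def cdf)
  have hmono: "h u \<le> h v" if "u \<le> v" "0 < G v" "0 < G u" for u v
    using mono_onD[OF mono] that by (simp add: cdf h_def)
  have Gmono: "G v \<le> G u" if "u \<le> v" for u v
    unfolding G_def using that by (intro finite_measure_mono) auto
  have diff: "ennreal (G a - G b) = (\<integral>\<^sup>+u. ennreal (f u) * indicator {a<..b} u \<partial>lborel)"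
    if "a \<le> b" for a b
  proof -
    have "G a = measure D {a<..b} + G b"
      unfolding G_def using that
      by (subst finite_measure_Union[symmetric]) (auto intro!: arg_cong[where f="measure D"])
    then have "ennreal (G a - G b) = emeasure D {a<..b}"
      by (simp add: emeasure_eq_measure)
    then show ?thesis by (subst (asm) D, subst (asm) emeasure_density) auto
  qed
  \<comment> \<open>On \<open>{a<..b}\<close> the density \<open>h u * G u\<close> lies between
    \<open>h a * G b\<close> and \<open>h b * G a\<close>. Integrating the lower estimate gives
    \<open>lower\<close>, the upper one gives \<open>upper\<close>.\<close>
  have lower: "G b * (1 + h a * (b - a)) \<le> G a" if "a \<le> b" "0 < G b" for a b
  proof -
    have pos: "0 < G u" if "u \<le> b" for u using Gmono[OF that] \<open>0 < G b\<close> by linarith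
    have "ennreal (h a * G b * (b - a)) = (\<integral>\<^sup>+u. ennreal (h a * G b) * indicator {a<..b} u \<partial>lborel)"
      using that h0[OF pos[of a]] by (subst nn_integral_cmult_indicator) (auto simp: ennreal_mult)
    also have "\<dots> \<le> ennreal (G a - G b)"
      unfolding diff[OF that(1)]
      using h h0 hmono[of a] Gmono pos that
      by (intro nn_integral_mono) (auto split: split_indicator intro!: ennreal_leI mult_mono simp: less_imp_le)
    finally have "h a * G b * (b - a) \<le> G a - G b"
      using Gmono[OF that(1)] by (subst (asm) ennreal_le_iff) auto
    then show ?thesis by (simp add: algebra_simps)
  qed
  have upper: "G a * (1 - h b * (b - a)) \<le> G b" if "a \<le> b" "0 < G b" for a b
  proof -
    have pos: "0 < G u" if "u \<le> b" for u using Gmono[OF that] \<open>0 < G b\<close> by linarith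
    have "ennreal (G a - G b) \<le> (\<integral>\<^sup>+u. ennreal (h b * G a) * indicator {a<..b} u \<partial>lborel)"
      unfolding diff[OF that(1)]
      using h h0 hmono[of _ b] Gmono pos that
      by (intro nn_integral_mono) (auto split: split_indicator intro!: ennreal_leI mult_mono simp: less_imp_le)
    also have "\<dots> = ennreal (h b * G a * (b - a))"
      using that h0[OF pos[of b]] pos[of a] by (subst nn_integral_cmult_indicator) (auto simp: ennreal_mult)
    finally have "G a - G b \<le> h b * G a * (b - a)"
      using that h0[OF pos[of b]] pos[of a] by (subst (asm) ennreal_le_iff) auto
    then show ?thesis by (simp add: algebra_simps)
  qed
  \<comment> \<open>A distribution with a density has no atom at 0, so \<open>G 0 = 1\<close>. This
    is the starting value for the decay bound on \<open>[0, x]\<close> below.\<close>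
  have "AE x in D. x \<noteq> 0"
    unfolding D by (subst AE_density) (auto intro: AE_mp[OF AE_lborel_singleton[of 0]])
  with assms(3) have "AE x in D. x \<in> {0<..}" by eventually_elim auto
  then show G0: "measure D {0<..} = 1" by (subst prob_eq_1) auto
  \<comment> \<open>For \<open>x \<le> y\<close>, the hazard rate is at least \<open>h y\<close> on \<open>[y, x + y]\<close> and at most \<open>h x \<le> h y\<close> on \<open>[0, x]\<close>.\<close>
  have main: "G (x + y) \<le> G x * G y" if "0 \<le> x" "x \<le> y" for x y
  proof (cases "0 < G (x + y)")
    case True
    have pos: "0 < G u" if "u \<le> x + y" for u using Gmono[OF that] True by linarith
    have "G (x + y) * exp (h y * x) = G (x + y) * exp (h y * ((x + y) - y))" by simp
    also have "\<dots> \<le> G y"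
    proof (rule exp_lower_growth)
      fix s t assume st: "y \<le> s" "s \<le> t" "t \<le> x + y"
      have "G t * (1 + h y * (t - s)) \<le> G t * (1 + h s * (t - s))"
        using st pos hmono by (intro mult_left_mono add_left_mono mult_right_mono) (auto simp: less_imp_le)
      also have "\<dots> \<le> G s" using lower st pos by auto
      finally show "G t * (1 + h y * (t - s)) \<le> G s" .
    qed (use that pos h0 in \<open>auto simp: G_def\<close>)
    finally have 1: "G (x + y) * exp (h y * x) \<le> G y" .
    have "G 0 * exp (- h x * (x - 0)) \<le> G x"
    proof (rule exp_upper_decay)
      fix s t assume st: "0 \<le> s" "s \<le> t" "t \<le> x"
      have "G s * (1 - h x * (t - s)) \<le> G s * (1 - h t * (t - s))"
        using st pos hmono that by (intro mult_left_mono diff_left_mono mult_right_mono) (auto simp: less_imp_le)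
      also have "\<dots> \<le> G t" using upper st pos that by auto
      finally show "G s * (1 - h x * (t - s)) \<le> G t" .
    qed (use that in auto)
    then have 2: "exp (- h x * x) \<le> G x" using G0 by (simp add: G_def)
    have "G (x + y) = G (x + y) * exp (h y * x) * exp (- h y * x)"
      by (simp add: mult.assoc flip: exp_add)
    also have "\<dots> \<le> G y * exp (- h y * x)" using 1 by (intro mult_right_mono) auto
    also have "\<dots> \<le> G y * exp (- h x * x)"
      using hmono[of x y] pos that by (intro mult_left_mono) (auto simp: G_def intro: mult_right_mono)
    also have "\<dots> \<le> G y * G x" using 2 by (intro mult_left_mono) (auto simp: G_def)
    finally show ?thesis by (simp add: mult.commute)
  next
    case False
    have "0 \<le> G x * G y" by (simp add: G_def)
    with False show ?thesis by linarith
  qed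
  show "measure D {x + y<..} \<le> measure D {x<..} * measure D {y<..}" if "0 \<le> x" "0 \<le> y"
    using main[of x y] main[of y x] that
    by (cases "x \<le> y") (auto simp: G_def add.commute mult.commute)
qed

section \<open>Exponential moments of NBU distributions\<close>

text \<open>Monotone convergence along \<open>{0..real n}\<close>. It lets the self-referential
  estimates below be carried out on truncated integrals, which are finite, before passing to the
  half-line.\<close>

lemma nn_integral_atLeast_le:
  assumes [measurable]: "f \<in> borel_measurable borel"
    and "\<And>n::nat. (\<integral>\<^sup>+u. f u * indicator {0..real n} u \<partial>lborel) \<le> C"
  shows "(\<integral>\<^sup>+u. f u * indicator {0..} u \<partial>lborel) \<le> C"
proof -
  have "(SUP n. f u * indicator {0..real n} u) = f u * indicator {0..} u" for u
  proof (cases "u \<ge> 0")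
    case True
    obtain k where "u \<le> real k" using real_arch_simple by blast
    show ?thesis
    proof (rule SUP_eqI)
      fix y assume "\<And>n::nat. n \<in> UNIV \<Longrightarrow> f u * indicator {0..real n} u \<le> y"
      from this[of k] show "f u * indicator {0..} u \<le> y"
        using True \<open>u \<le> real k\<close> by simp
    qed (auto split: split_indicator)
  qed simp
  then have "(\<integral>\<^sup>+u. f u * indicator {0..} u \<partial>lborel)
      = (\<integral>\<^sup>+u. (SUP n. f u * indicator {0..real n} u) \<partial>lborel)" by simp
  also have "\<dots> = (SUP n. \<integral>\<^sup>+u. f u * indicator {0..real n} u \<partial>lborel)"
    by (intro nn_integral_monotone_convergence_SUP)
       (auto simp: incseq_def le_fun_def split: split_indicator)
  also have "\<dots> \<le> C" using assms(2) by (intro SUP_least)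
  finally show ?thesis .
qed

text \<open>Half of \<open>A\<close> is absorbed into the left-hand side. The subtraction is
  legitimate because \<open>A\<close> is finite, so it is done on real numbers.\<close>

lemma ennreal_le_add_half_self:
  assumes "A < \<infinity>" "0 \<le> a" "A \<le> ennreal a + ennreal (1 / 2) * A"
  shows "A \<le> ennreal (2 * a)"
proof -
  obtain r where r: "A = ennreal r" "0 \<le> r" using assms(1) by (cases A) auto
  have "ennreal a + ennreal (1 / 2) * ennreal r = ennreal (a + 1 / 2 * r)"
    using assms(2) r(2) by (metis ennreal_mult ennreal_plus mult_nonneg_nonneg zero_le_divide_1_iff zero_le_numeral)
  with assms(3) r have "ennreal r \<le> ennreal (a + 1 / 2 * r)" by simp
  then have "r \<le> a + 1 / 2 * r" using assms(2) r(2) by (subst (asm) ennreal_le_iff) auto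
  then show ?thesis using r by (simp add: ennreal_leI)
qed

lemma nn_integral_translate:
  assumes [measurable]: "f \<in> borel_measurable borel"
  shows "(\<integral>\<^sup>+u. f u \<partial>lborel) = (\<integral>\<^sup>+u. f (a + u :: real) \<partial>lborel)"
  using nn_integral_real_affine[of f 1 a] by simp

text \<open>Each shift by \<open>a\<close> at least halves \<open>G\<close>, so the integral is
  dominated by the geometric series \<open>a + a / 2 + a / 4 + ...\<close>, with sum
  \<open>2 * a\<close>. Instead of summing it, the proof splits the truncated integral at
  \<open>a\<close> and shifts the remainder, obtaining
  \<open>F (a + L) \<le> a + F (a + L) / 2\<close>.\<close>

lemma nn_integral_NBU_finite:
  fixes G :: "real \<Rightarrow> real"
  assumes [measurable]: "G \<in> borel_measurable borel"
    and G: "\<And>x. 0 \<le> G x" "\<And>x. G x \<le> 1"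
    and nbu: "\<And>x y. 0 \<le> x \<Longrightarrow> 0 \<le> y \<Longrightarrow> G (x + y) \<le> G x * G y"
    and a: "0 \<le> a" "G a \<le> 1 / 2"
  shows "(\<integral>\<^sup>+u. ennreal (G u) * indicator {0..} u \<partial>lborel) < \<infinity>"
proof -
  define F where "F L = (\<integral>\<^sup>+u. ennreal (G u) * indicator {0..L} u \<partial>lborel)" for L :: real
  have fin: "F L < \<infinity>" for L
  proof -
    have "F L \<le> (\<integral>\<^sup>+u. 1 * indicator {0..L} u \<partial>lborel)"
      unfolding F_def using G by (intro nn_integral_mono mult_right_mono) auto
    also have "\<dots> < \<infinity>" by (subst nn_integral_cmult_indicator) (auto simp: emeasure_lborel_Icc_eq)
    finally show ?thesis .
  qed
  have bound: "F (a + L) \<le> ennreal (2 * a)" if "0 \<le> L" for L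
  proof -
    have "F (a + L) \<le> (\<integral>\<^sup>+u. (1 * indicator {0..a} u + ennreal (G u) * indicator {a..a+L} u) \<partial>lborel)"
      unfolding F_def using G(2)
      by (intro nn_integral_mono) (auto split: split_indicator)
    also have "\<dots> = ennreal a + (\<integral>\<^sup>+u. ennreal (G u) * indicator {a..a+L} u \<partial>lborel)"
      using a by (subst nn_integral_add, simp, simp, subst nn_integral_cmult_indicator) auto
    also have "(\<integral>\<^sup>+u. ennreal (G u) * indicator {a..a+L} u \<partial>lborel)
        = (\<integral>\<^sup>+u. ennreal (G (a + u)) * indicator {a..a+L} (a + u) \<partial>lborel)"
      by (rule nn_integral_translate) simp
    also have "\<dots> \<le> (\<integral>\<^sup>+u. ennreal (1/2) * (ennreal (G u) * indicator {0..L} u) \<partial>lborel)"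
    proof (intro nn_integral_mono)
      fix u :: real
      have "ennreal (G (a + u)) \<le> ennreal (1/2) * ennreal (G u)" if "0 \<le> u"
        using nbu[OF a(1) that] mult_right_mono[OF a(2) G(1)[of u]] G
        by (subst ennreal_mult[symmetric]) (auto intro!: ennreal_leI)
      then show "ennreal (G (a + u)) * indicator {a..a+L} (a + u)
          \<le> ennreal (1/2) * (ennreal (G u) * indicator {0..L} u)"
        by (auto split: split_indicator)
    qed
    also have "\<dots> = ennreal (1/2) * F L"
      unfolding F_def by (intro nn_integral_cmult) auto
    also have "F L \<le> F (a + L)"
      unfolding F_def using a by (intro nn_integral_mono) (auto split: split_indicator)
    finally have "F (a + L) \<le> ennreal a + ennreal (1/2) * F (a + L)"
      by (simp add: mult_left_mono add_left_mono)
    with fin a(1) show ?thesis by (rule ennreal_le_add_half_self)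
  qed
  have "(\<integral>\<^sup>+u. ennreal (G u) * indicator {0..} u \<partial>lborel) \<le> ennreal (2 * a)"
  proof (rule nn_integral_atLeast_le)
    fix n :: nat
    have "F (real n) \<le> F (a + real n)"
      unfolding F_def using a by (intro nn_integral_mono) (auto split: split_indicator)
    then show "(\<integral>\<^sup>+u. ennreal (G u) * indicator {0..real n} u \<partial>lborel) \<le> ennreal (2 * a)"
      using bound[of n] by (simp add: F_def)
  qed simp
  then show ?thesis by (auto intro: le_less_trans)
qed

lemma nn_integral_exp:
  assumes "0 < s" "0 \<le> (x :: real)"
  shows "(\<integral>\<^sup>+v. ennreal (s * exp (s * v)) * indicator {0..x} v \<partial>lborel) = ennreal (exp (s * x) - 1)"
  using assms by (subst nn_integral_FTC_Icc[where F="\<lambda>v. exp (s * v)"])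
    (auto intro!: derivative_eq_intros)

text \<open>
  With \<open>s = 1 / (2 * \<mu>)\<close>, Fubini and \<open>\<integral>\<^sub>v\<^sup>\<infinity> G \<le> \<mu> G v\<close> bound \<open>A = \<integral> exp (s u) G u du\<close> by
  \<open>\<mu> + s \<mu> A = \<mu> + A / 2\<close>. Truncating the integral makes \<open>A\<close> finite, so that it can be
  subtracted.
\<close>

lemma nn_integral_NBU_exp_le:
  fixes G :: "real \<Rightarrow> real"
  assumes [measurable]: "G \<in> borel_measurable borel"
    and G: "\<And>x. 0 \<le> G x" "\<And>x. G x \<le> 1"
    and nbu: "\<And>x y. 0 \<le> x \<Longrightarrow> 0 \<le> y \<Longrightarrow> G (x + y) \<le> G x * G y"
    and mu: "0 < \<mu>" "(\<integral>\<^sup>+u. ennreal (G u) * indicator {0..} u \<partial>lborel) = ennreal \<mu>"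
  shows "(\<integral>\<^sup>+u. ennreal (exp (u / (2 * \<mu>))) * ennreal (G u) * indicator {0..} u \<partial>lborel) \<le> ennreal (2 * \<mu>)"
proof (rule nn_integral_atLeast_le)
  fix n :: nat
  define s where "s = 1 / (2 * \<mu>)"
  have s: "0 < s" "s * \<mu> = 1 / 2" using mu by (auto simp: s_def)
  define A where "A = (\<integral>\<^sup>+u. ennreal (exp (s * u)) * ennreal (G u) * indicator {0..real n} u \<partial>lborel)"
  have "exp (s * u) * G u \<le> exp (s * real n)" if "u \<le> real n" for u
    using mult_mono[of "exp (s * u)" "exp (s * real n)" "G u" 1] G s that by simp
  then have "A \<le> (\<integral>\<^sup>+u. ennreal (exp (s * real n)) * indicator {0..real n} u \<partial>lborel)"
    unfolding A_def using G
    by (intro nn_integral_mono)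
      (auto split: split_indicator simp: ennreal_mult[symmetric] intro!: ennreal_leI)
  also have "\<dots> < \<infinity>"
    by (subst nn_integral_cmult_indicator) (auto simp: ennreal_mult_less_top)
  finally have fin: "A < \<infinity>" .
  have tail: "(\<integral>\<^sup>+u. ennreal (G u) * indicator {v..} u \<partial>lborel) \<le> ennreal (G v) * ennreal \<mu>"
    if "0 \<le> v" for v
  proof -
    have "(\<integral>\<^sup>+u. ennreal (G u) * indicator {v..} u \<partial>lborel)
        = (\<integral>\<^sup>+u. ennreal (G (v + u)) * indicator {v..} (v + u) \<partial>lborel)"
      by (rule nn_integral_translate) simp
    also have "\<dots> \<le> (\<integral>\<^sup>+u. ennreal (G v) * (ennreal (G u) * indicator {0..} u) \<partial>lborel)"
      using nbu that G by (intro nn_integral_mono)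
        (auto split: split_indicator simp: ennreal_mult[symmetric] intro!: ennreal_leI)
    also have "\<dots> = ennreal (G v) * ennreal \<mu>"
      by (subst nn_integral_cmult) (simp_all add: mu)
    finally show ?thesis .
  qed
  \<comment> \<open>The exponential is 1 plus the integral of its derivative over \<open>v\<close>
    in \<open>{0..u}\<close>. The truncation at \<open>n\<close> moves from \<open>u\<close> to
    \<open>v\<close>: after the exchange of integrals the inner one is a full tail of
    \<open>G\<close>, and the outer one reproduces \<open>A\<close>.\<close>
  have "A \<le> (\<integral>\<^sup>+u. (ennreal (G u) * indicator {0..} u +
      (\<integral>\<^sup>+v. ennreal (s * exp (s * v)) * indicator {0..real n} v * (ennreal (G u) * indicator {v..} u) \<partial>lborel)) \<partial>lborel)"
    unfolding A_def
  proof (intro nn_integral_mono)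
    fix u :: real
    show "ennreal (exp (s * u)) * ennreal (G u) * indicator {0..real n} u \<le> ennreal (G u) * indicator {0..} u +
      (\<integral>\<^sup>+v. ennreal (s * exp (s * v)) * indicator {0..real n} v * (ennreal (G u) * indicator {v..} u) \<partial>lborel)"
    proof (cases "0 \<le> u \<and> u \<le> real n")
      case True
      have "ennreal (exp (s * u)) = 1 + ennreal (exp (s * u) - 1)"
        using True s by (simp flip: ennreal_1 ennreal_plus)
      also have "\<dots> = 1 + (\<integral>\<^sup>+v. ennreal (s * exp (s * v)) * indicator {0..u} v \<partial>lborel)"
        using nn_integral_exp[OF s(1), of u] True by simp
      finally have "ennreal (exp (s * u)) * ennreal (G u) = ennreal (G u) +
          (\<integral>\<^sup>+v. ennreal (s * exp (s * v)) * indicator {0..u} v \<partial>lborel) * ennreal (G u)"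
        by (simp add: distrib_right)
      also have "(\<integral>\<^sup>+v. ennreal (s * exp (s * v)) * indicator {0..u} v \<partial>lborel) * ennreal (G u)
         = (\<integral>\<^sup>+v. ennreal (s * exp (s * v)) * indicator {0..u} v * ennreal (G u) \<partial>lborel)"
        by (rule nn_integral_multc[symmetric]) simp
      also have "\<dots> \<le> (\<integral>\<^sup>+v. ennreal (s * exp (s * v)) * indicator {0..real n} v * (ennreal (G u) * indicator {v..} u) \<partial>lborel)"
        using True by (intro nn_integral_mono) (auto split: split_indicator)
      finally show ?thesis using True by (simp add: add_left_mono)
    qed auto
  qed
  also have "\<dots> = ennreal \<mu> + (\<integral>\<^sup>+u. \<integral>\<^sup>+v. ennreal (s * exp (s * v)) * indicator {0..real n} v *
      (ennreal (G u) * indicator {v..} u) \<partial>lborel \<partial>lborel)"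
    unfolding atLeast_def by (subst nn_integral_add) (simp_all add: mu(2)[unfolded atLeast_def])
  also have "(\<integral>\<^sup>+u. \<integral>\<^sup>+v. ennreal (s * exp (s * v)) * indicator {0..real n} v *
      (ennreal (G u) * indicator {v..} u) \<partial>lborel \<partial>lborel)
    = (\<integral>\<^sup>+v. \<integral>\<^sup>+u. ennreal (s * exp (s * v)) * indicator {0..real n} v *
      (ennreal (G u) * indicator {v..} u) \<partial>lborel \<partial>lborel)"
    unfolding atLeast_def by (rule lborel_pair.Fubini') simp
  also have "\<dots> = (\<integral>\<^sup>+v. ennreal (s * exp (s * v)) * indicator {0..real n} v *
      (\<integral>\<^sup>+u. ennreal (G u) * indicator {v..} u \<partial>lborel) \<partial>lborel)"
    by (subst nn_integral_cmult) auto
  also have "\<dots> \<le> (\<integral>\<^sup>+v. ennreal (1/2) * (ennreal (exp (s * v)) * ennreal (G v) * indicator {0..real n} v) \<partial>lborel)"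
  proof (intro nn_integral_mono)
    fix v :: real
    have "ennreal (s * exp (s * v)) * (\<integral>\<^sup>+u. ennreal (G u) * indicator {v..} u \<partial>lborel)
      \<le> ennreal (1/2) * (ennreal (exp (s * v)) * ennreal (G v))" if "0 \<le> v"
    proof -
      have "ennreal (s * exp (s * v)) * (\<integral>\<^sup>+u. ennreal (G u) * indicator {v..} u \<partial>lborel)
        \<le> ennreal (s * exp (s * v)) * (ennreal (G v) * ennreal \<mu>)"
        by (intro mult_left_mono tail that) simp
      also have "\<dots> = ennreal (s * \<mu> * (exp (s * v) * G v))"
        using G s mu by (simp add: ennreal_mult[symmetric] mult_ac)
      also have "\<dots> = ennreal (1/2) * (ennreal (exp (s * v)) * ennreal (G v))"
        using G ennreal_mult[of "1/2" "exp (s * v) * G v"] ennreal_mult[of "exp (s * v)" "G v"]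
        unfolding s by simp
      finally show ?thesis .
    qed
    then show "ennreal (s * exp (s * v)) * indicator {0..real n} v *
      (\<integral>\<^sup>+u. ennreal (G u) * indicator {v..} u \<partial>lborel)
      \<le> ennreal (1/2) * (ennreal (exp (s * v)) * ennreal (G v) * indicator {0..real n} v)"
      by (auto split: split_indicator)
  qed
  also have "\<dots> = ennreal (1/2) * A"
    unfolding A_def by (intro nn_integral_cmult) auto
  finally have "A \<le> ennreal \<mu> + ennreal (1/2) * A" by (simp add: add_left_mono)
  with fin have "A \<le> ennreal (2 * \<mu>)" using mu by (intro ennreal_le_add_half_self) auto
  then show "(\<integral>\<^sup>+u. ennreal (exp (u / (2 * \<mu>))) * ennreal (G u) * indicator {0..real n} u \<partial>lborel) \<le> ennreal (2 * \<mu>)"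
    by (simp add: A_def s_def)
qed simp

text \<open>Tonelli on the region between 0 and \<open>x\<close>. Replacing \<open>u \<le> x\<close>
  by \<open>u < x\<close> changes the inner integrand at the single point \<open>u = x\<close> at
  most, which is Lebesgue null, and produces the strict tails \<open>{u<..}\<close>.\<close>

lemma layer_cake:
  fixes N :: "real measure"
  assumes "prob_space N" and [measurable_cong]: "sets N = sets borel"
    and [measurable]: "g \<in> borel_measurable borel"
  shows "(\<integral>\<^sup>+x. (\<integral>\<^sup>+u. g u * indicator {0..x} u \<partial>lborel) \<partial>N)
       = (\<integral>\<^sup>+u. g u * ennreal (measure N {u<..}) * indicator {0..} u \<partial>lborel)"
proof -
  interpret prob_space N by fact
  interpret pair_sigma_finite N lborel ..
  have [simp]: "space N = UNIV" using sets_eq_imp_space_eq[OF assms(2)] by simp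
  have "(\<integral>\<^sup>+x. (\<integral>\<^sup>+u. g u * indicator {0..x} u \<partial>lborel) \<partial>N)
      = (\<integral>\<^sup>+x. (\<integral>\<^sup>+u. g u * indicator {0..} u * indicator {u<..} x \<partial>lborel) \<partial>N)"
  proof (rule nn_integral_cong, rule nn_integral_cong_AE)
    fix x :: real
    show "AE u in lborel. g u * indicator {0..x} u = g u * indicator {0..} u * indicator {u<..} x"
      using AE_lborel_singleton[of x] by eventually_elim (auto split: split_indicator)
  qed
  also have "\<dots> = (\<integral>\<^sup>+u. (\<integral>\<^sup>+x. g u * indicator {0..} u * indicator {u<..} x \<partial>N) \<partial>lborel)"
    unfolding greaterThan_def by (rule Fubini'[symmetric]) simp
  also have "\<dots> = (\<integral>\<^sup>+u. g u * ennreal (measure N {u<..}) * indicator {0..} u \<partial>lborel)"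
    by (subst nn_integral_cmult_indicator) (auto simp: emeasure_eq_measure mult_ac)
  finally show ?thesis .
qed

text \<open>Two uses of the layer cake formula: weight 1 turns the mean into the integral of
  \<open>G\<close>, and weight \<open>s * exp (s * u)\<close> with
  \<open>s = 1 / (2 * \<mu>)\<close> turns the exponential moment into \<open>1 + s * A\<close>,
  where \<open>A \<le> 2 * \<mu>\<close>. Hence the bound \<open>1 + 1 = 2\<close>.\<close>

lemma NBU_exp_moment:
  fixes N :: "real measure"
  assumes "prob_space N" and sets_N: "sets N = sets borel"
    and 0: "measure N {0<..} = 1"
    and nbu: "\<And>x y. 0 \<le> x \<Longrightarrow> 0 \<le> y \<Longrightarrow> measure N {x + y<..} \<le> measure N {x<..} * measure N {y<..}"
  defines "\<mu> \<equiv> \<integral>x. x \<partial>N"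
  shows "integrable N (\<lambda>x. x)" "0 < \<mu>"
    "integrable N (\<lambda>x. exp (x / (2 * \<mu>)))" "(\<integral>x. exp (x / (2 * \<mu>)) \<partial>N) \<le> 2"
proof -
  interpret prob_space N by fact
  note [measurable_cong] = sets_N
  have [simp]: "space N = UNIV" using sets_eq_imp_space_eq[OF sets_N] by simp
  have pos_AE: "AE x in N. x \<in> {0<..}" using 0 by (subst (asm) prob_eq_1) auto
  then have nonneg: "AE x in N. 0 \<le> x" by eventually_elim auto
  define G where "G x = measure N {x<..}" for x
  have nbu_G: "G (x + y) \<le> G x * G y" if "0 \<le> x" "0 \<le> y" for x y
    using nbu that by (simp add: G_def)
  have Gmono: "G v \<le> G u" if "u \<le> v" for u v
    unfolding G_def using that by (intro finite_measure_mono) auto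
  have "(\<lambda>x. - G x) \<in> borel_measurable borel"
    using Gmono by (intro borel_measurable_mono) (auto simp: mono_def)
  then have [measurable]: "G \<in> borel_measurable borel" by simp
  have G: "\<And>x. 0 \<le> G x" "\<And>x. G x \<le> 1" by (auto simp: G_def)
  \<comment> \<open>Tails of a probability measure vanish, so some \<open>n\<close> has
    \<open>G (real n) < 1/2\<close>; it serves as the halving length in
    \<open>nn_integral_NBU_finite\<close>.\<close>
  have "(\<lambda>n. G (real n)) \<longlonglongrightarrow> measure N (\<Inter>n::nat. {real n<..})"
    unfolding G_def by (intro finite_Lim_measure_decseq) (auto simp: decseq_def)
  moreover have "(\<Inter>n::nat. {real n<..}) = {}"
    using real_arch_simple by (auto simp: set_eq_iff not_less)
  ultimately have "(\<lambda>n. G (real n)) \<longlonglongrightarrow> 0" by simp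
  then have "\<forall>\<^sub>F n in sequentially. G (real n) < 1/2" by (rule order_tendstoD) simp
  then obtain n :: nat where n: "G (real n) < 1/2" by (auto simp: eventually_sequentially)
  have fin: "(\<integral>\<^sup>+u. ennreal (G u) * indicator {0..} u \<partial>lborel) < \<infinity>"
    using nbu_G n by (intro nn_integral_NBU_finite[of G "real n"] G) auto
  have "(\<integral>\<^sup>+x. ennreal x \<partial>N) = (\<integral>\<^sup>+x. (\<integral>\<^sup>+u. 1 * indicator {0..x} u \<partial>lborel) \<partial>N)"
  proof (rule nn_integral_cong_AE)
    show "AE x in N. ennreal x = (\<integral>\<^sup>+u. 1 * indicator {0..x} u \<partial>lborel)"
      using nonneg by eventually_elim simp
  qed
  also have "\<dots> = (\<integral>\<^sup>+u. ennreal (G u) * indicator {0..} u \<partial>lborel)"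
    using layer_cake[OF assms(1,2), of "\<lambda>_. 1"] by (simp add: G_def)
  finally have mean: "(\<integral>\<^sup>+x. ennreal x \<partial>N) = (\<integral>\<^sup>+u. ennreal (G u) * indicator {0..} u \<partial>lborel)" .
  show int: "integrable N (\<lambda>x. x)"
    using nonneg fin mean by (intro integrableI_nonneg) auto
  have mu: "ennreal \<mu> = (\<integral>\<^sup>+u. ennreal (G u) * indicator {0..} u \<partial>lborel)"
    unfolding \<mu>_def mean[symmetric] using nonneg by (intro nn_integral_eq_integral[symmetric] int)
  have mu0: "0 \<le> \<mu>" unfolding \<mu>_def using nonneg by (rule integral_nonneg_AE)
  show pos: "0 < \<mu>"
  proof (rule ccontr)
    assume "\<not> 0 < \<mu>"
    then have "AE x in N. x = 0"
      using mu0 integral_nonneg_eq_0_iff_AE[OF int nonneg] by (simp add: \<mu>_def)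
    with pos_AE have "AE x in N. False" by eventually_elim auto
    then show False by simp
  qed
  define s where "s = 1 / (2 * \<mu>)"
  have s: "0 < s" using pos by (simp add: s_def)
  have "(\<integral>\<^sup>+x. ennreal (exp (s * x)) \<partial>N)
      = (\<integral>\<^sup>+x. 1 + (\<integral>\<^sup>+u. ennreal (s * exp (s * u)) * indicator {0..x} u \<partial>lborel) \<partial>N)"
    using nonneg
  proof (intro nn_integral_cong_AE, eventually_elim)
    case (elim x)
    then show ?case using s by (subst nn_integral_exp) (auto simp flip: ennreal_1 ennreal_plus)
  qed
  also have "\<dots> = 1 + (\<integral>\<^sup>+x. (\<integral>\<^sup>+u. ennreal (s * exp (s * u)) * indicator {0..x} u \<partial>lborel) \<partial>N)"
    unfolding atLeastAtMost_def atLeast_def atMost_def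
    by (subst nn_integral_add) (auto simp: emeasure_space_1[simplified])
  also have "\<dots> = 1 + (\<integral>\<^sup>+u. ennreal s * (ennreal (exp (u / (2 * \<mu>))) * ennreal (G u) * indicator {0..} u) \<partial>lborel)"
  proof -
    have "ennreal (s * exp (s * u)) = ennreal s * ennreal (exp (u / (2 * \<mu>)))" for u
      using s ennreal_mult[of s "exp (s * u)"] by (simp add: s_def)
    then show ?thesis by (subst layer_cake[OF assms(1,2)]) (simp_all add: G_def mult.assoc)
  qed
  also have "\<dots> = 1 + ennreal s * (\<integral>\<^sup>+u. ennreal (exp (u / (2 * \<mu>))) * ennreal (G u) * indicator {0..} u \<partial>lborel)"
    by (subst nn_integral_cmult) auto
  also have "\<dots> \<le> 1 + ennreal s * ennreal (2 * \<mu>)"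
    using nbu_G mu pos
    by (intro add_left_mono mult_left_mono nn_integral_NBU_exp_le G) auto
  also have "\<dots> = ennreal 2"
    using pos s by (simp add: s_def flip: ennreal_mult ennreal_1 ennreal_plus del: ennreal_1)
  finally have le: "(\<integral>\<^sup>+x. ennreal (exp (x / (2 * \<mu>))) \<partial>N) \<le> ennreal 2" by (simp add: s_def)
  then show int': "integrable N (\<lambda>x. exp (x / (2 * \<mu>)))"
    by (intro integrableI_nonneg) (auto intro: le_less_trans)
  show "(\<integral>x. exp (x / (2 * \<mu>)) \<partial>N) \<le> 2"
    using le unfolding nn_integral_eq_integral[OF int' AE_I2[OF exp_ge_zero]]
    by (subst (asm) ennreal_le_iff) auto
qed

section \<open>Makespans of VCG and OPT\<close>

definition min_entry :: "nat \<Rightarrow> (nat \<Rightarrow> real) \<Rightarrow> real" where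
  "min_entry n c = (MIN i\<in>{..<n}. c i)"

text \<open>\<open>share n c i\<close> is the probability that VCG gives a task with processing times \<open>c\<close> to machine \<open>i\<close>.\<close>

definition share :: "nat \<Rightarrow> (nat \<Rightarrow> real) \<Rightarrow> nat \<Rightarrow> real" where
  "share n c i = (if c i = min_entry n c
     then 1 / (\<Sum>k<n. if c k = min_entry n c then 1 else 0) else 0)"

lemma fastest_machines_eq:
  "fastest_machines n t j = {i. i < n \<and> t i j = min_entry n (\<lambda>i. t i j)}"
  by (simp add: fastest_machines_def min_entry_def)

lemma fastest_machines_finite: "finite (fastest_machines n t j)"
  by (simp add: fastest_machines_def)

lemma fastest_machines_nonempty:
  assumes "1 \<le> n"
  shows "fastest_machines n t j \<noteq> {}"
proof -
  have "(MIN i'\<in>{..<n}. t i' j) \<in> (\<lambda>i. t i j) ` {..<n}"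
    using assms by (intro Min_in) (auto simp: lessThan_empty_iff)
  then show ?thesis by (force simp: fastest_machines_def)
qed

text \<open>The denominator in \<open>share\<close> counts the minimisers. The explicit formula is
  what measurability and relabelling arguments work with; this equation ties it to the uniform
  tie-breaking.\<close>

lemma share_eq:
  assumes "i < n"
  shows "share n (\<lambda>i. t i j) i = pmf (pmf_of_set (fastest_machines n t j)) i"
proof -
  have "(\<Sum>k<n. if t k j = min_entry n (\<lambda>i. t i j) then 1 else 0 :: real)
      = real (card (fastest_machines n t j))"
    by (simp add: fastest_machines_eq sum.If_cases Int_def)
  moreover have "fastest_machines n t j \<noteq> {}"
    using assms by (intro fastest_machines_nonempty) simp
  ultimately show ?thesis
    using assms fastest_machines_finite by (simp add: share_def fastest_machines_eq)
qed

lemma share_nonneg: "0 \<le> share n c i"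
  by (auto simp: share_def intro!: sum_nonneg)

lemma share_le_1: "i < n \<Longrightarrow> share n c i \<le> 1"
  using share_eq[of i n "\<lambda>i _. c i" 0] by (simp add: pmf_le_1)

lemma sum_share:
  assumes "1 \<le> n"
  shows "(\<Sum>i<n. share n c i) = 1"
proof -
  let ?F = "fastest_machines n (\<lambda>i _. c i) 0"
  have "(\<Sum>i<n. share n c i) = (\<Sum>i<n. pmf (pmf_of_set ?F) i)"
    using share_eq[of _ n "\<lambda>i _. c i" 0] by simp
  also have "\<dots> = 1"
    using assms fastest_machines_finite[of n "\<lambda>i _. c i" 0] fastest_machines_nonempty[of n "\<lambda>i _. c i" 0]
    by (intro sum_pmf_eq_1) (auto simp: fastest_machines_def)
  finally show ?thesis .
qed

lemma min_entry_cong: "(\<And>i. i < n \<Longrightarrow> c i = d i) \<Longrightarrow> min_entry n c = min_entry n d"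
  unfolding min_entry_def by (metis image_cong lessThan_iff)

lemma share_cong: "i < n \<Longrightarrow> (\<And>i. i < n \<Longrightarrow> c i = d i) \<Longrightarrow> share n c i = share n d i"
  unfolding share_def using min_entry_cong[of n c d]
  by (auto intro!: arg_cong[where f="\<lambda>x. 1 / x"] sum.cong)

lemma min_entry_permute:
  assumes "bij_betw p {..<n} {..<n}"
  shows "min_entry n (\<lambda>i. c (p i)) = min_entry n c"
  using assms unfolding min_entry_def bij_betw_def by (metis image_image)

text \<open>Relabelling the machines changes neither the minimum nor the number of minimisers. This
  is the source of the symmetry between machines.\<close>

lemma share_permute:
  assumes "bij_betw p {..<n} {..<n}"
  shows "share n (\<lambda>i. c (p i)) i = share n c (p i)"
  unfolding share_def min_entry_permute[OF assms]
  using sum.reindex_bij_betw[OF assms, of "\<lambda>k. if c k = min_entry n c then 1 else 0 :: real"]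
  by simp

lemma borel_measurable_min_entry:
  assumes "\<And>i. i < n \<Longrightarrow> (\<lambda>x. c x i) \<in> borel_measurable M"
  shows "(\<lambda>x. min_entry n (c x)) \<in> borel_measurable M"
  unfolding min_entry_def using assms by (intro borel_measurable_Min) auto

lemma borel_measurable_share:
  assumes c: "\<And>i. i < n \<Longrightarrow> (\<lambda>x. c x i) \<in> borel_measurable M" and "i < n"
  shows "(\<lambda>x. share n (c x) i) \<in> borel_measurable M"
proof -
  have eq: "Measurable.pred M (\<lambda>x. c x i = min_entry n (c x))" if "i < n" for i
    using c[OF that] borel_measurable_min_entry[OF c] by measurable
  then show ?thesis unfolding share_def
    using assms by (intro measurable_If borel_measurable_divide borel_measurable_sum) auto
qed

text \<open>For an optimal assignment, the sum of the \<open>n\<close> loads is at most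
  \<open>n\<close> times the largest, and every task costs at least its column minimum wherever it
  is placed.\<close>

lemma OPT_ge:
  assumes "1 \<le> n"
  shows "(\<Sum>j<m. min_entry n (\<lambda>i. t i j)) \<le> real n * OPT n m t"
proof -
  let ?A = "{..<m} \<rightarrow>\<^sub>E {..<n}"
  have fin: "finite ?A" "?A \<noteq> {}" using assms by (auto intro!: finite_PiE simp: PiE_eq_empty_iff lessThan_empty_iff)
  then have "OPT n m t \<in> makespan n m t ` ?A" unfolding OPT_def by (intro Min_in) auto
  then obtain a where a: "a \<in> ?A" "OPT n m t = makespan n m t a" by auto
  have "(\<Sum>j<m. min_entry n (\<lambda>i. t i j)) \<le> (\<Sum>j<m. t (a j) j)"
    using a(1) by (intro sum_mono) (auto simp: min_entry_def PiE_iff intro!: Min_le)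
  also have "\<dots> = (\<Sum>i<n. \<Sum>j\<in>{j. j < m \<and> a j = i}. t (a j) j)"
    using a(1) sum.group[of "{..<m}" "{..<n}" a "\<lambda>j. t (a j) j"]
    by (simp add: PiE_iff image_subset_iff)
  also have "\<dots> = (\<Sum>i<n. \<Sum>j\<in>{j. j < m \<and> a j = i}. t i j)"
    by (intro sum.cong) auto
  also have "\<dots> \<le> (\<Sum>i<n. makespan n m t a)"
    unfolding makespan_def by (intro sum_mono Max_ge) auto
  finally show ?thesis using a by simp
qed

text \<open>A crude bound, independent of the assignment, that supplies an integrable dominating
  function for both \<open>OPT\<close> and \<open>VCG\<close>.\<close>

lemma makespan_abs_le:
  assumes "1 \<le> n"
  shows "\<bar>makespan n m t a\<bar> \<le> (\<Sum>i<n. \<Sum>j<m. \<bar>t i j\<bar>)"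
proof -
  have "makespan n m t a \<in> (\<lambda>i. \<Sum>j\<in>{j. j < m \<and> a j = i}. t i j) ` {..<n}"
    unfolding makespan_def using assms by (intro Max_in) (auto simp: lessThan_empty_iff)
  then obtain i where i: "i < n" "makespan n m t a = (\<Sum>j\<in>{j. j < m \<and> a j = i}. t i j)" by auto
  have "\<bar>makespan n m t a\<bar> \<le> (\<Sum>j\<in>{j. j < m \<and> a j = i}. \<bar>t i j\<bar>)"
    unfolding i(2) by (rule sum_abs)
  also have "\<dots> \<le> (\<Sum>j<m. \<bar>t i j\<bar>)" by (intro sum_mono2) auto
  also have "\<dots> \<le> (\<Sum>i<n. \<Sum>j<m. \<bar>t i j\<bar>)"
    using i(1) by (intro member_le_sum[of _ _ "\<lambda>i. \<Sum>j<m. \<bar>t i j\<bar>"] sum_nonneg) auto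
  finally show ?thesis .
qed

lemma OPT_abs_le:
  assumes "1 \<le> n"
  shows "\<bar>OPT n m t\<bar> \<le> (\<Sum>i<n. \<Sum>j<m. \<bar>t i j\<bar>)"
proof -
  let ?A = "{..<m} \<rightarrow>\<^sub>E {..<n}"
  have "finite ?A" "?A \<noteq> {}" using assms by (auto intro!: finite_PiE simp: PiE_eq_empty_iff lessThan_empty_iff)
  then have "OPT n m t \<in> makespan n m t ` ?A" unfolding OPT_def by (intro Min_in) auto
  then show ?thesis using makespan_abs_le[OF assms] by auto
qed

section \<open>The law of the VCG assignment\<close>

lemma set_VCG_assignment:
  assumes "1 \<le> n"
  shows "set_pmf (VCG_assignment n m t) \<subseteq> {..<m} \<rightarrow>\<^sub>E {..<n}"
  unfolding VCG_assignment_def using assms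
  by (auto simp: set_Pi_pmf PiE_dflt_def PiE_iff extensional_def fastest_machines_nonempty
      fastest_machines_finite) (auto simp: fastest_machines_def)

lemma finite_set_VCG_assignment:
  assumes "1 \<le> n"
  shows "finite (set_pmf (VCG_assignment n m t))"
  using set_VCG_assignment[OF assms] by (rule finite_subset) (auto intro!: finite_PiE)

text \<open>A finite sum over a set of assignments that does not depend on \<open>t\<close>;
  measurability of \<open>VCG\<close> in random processing times is read off from it.\<close>

lemma VCG_eq_sum:
  assumes "1 \<le> n"
  shows "VCG n m t = (\<Sum>a\<in>{..<m} \<rightarrow>\<^sub>E {..<n}. makespan n m t a * (\<Prod>j<m. share n (\<lambda>i. t i j) (a j)))"
proof -
  have "VCG n m t = (\<Sum>a\<in>{..<m} \<rightarrow>\<^sub>E {..<n}. makespan n m t a * pmf (VCG_assignment n m t) a)"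
    unfolding VCG_def using set_VCG_assignment[OF assms]
    by (intro integral_measure_pmf_real) (auto intro!: finite_PiE)
  also have "\<dots> = (\<Sum>a\<in>{..<m} \<rightarrow>\<^sub>E {..<n}. makespan n m t a * (\<Prod>j<m. share n (\<lambda>i. t i j) (a j)))"
  proof (intro sum.cong refl arg_cong2[where f="(*)"])
    fix a assume a: "a \<in> {..<m} \<rightarrow>\<^sub>E {..<n}"
    then show "pmf (VCG_assignment n m t) a = (\<Prod>j<m. share n (\<lambda>i. t i j) (a j))"
      unfolding VCG_assignment_def
      by (subst pmf_Pi') (auto simp: PiE_iff extensional_def share_eq)
  qed
  finally show ?thesis .
qed

lemma VCG_abs_le:
  assumes "1 \<le> n"
  shows "\<bar>VCG n m t\<bar> \<le> (\<Sum>i<n. \<Sum>j<m. \<bar>t i j\<bar>)"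
proof -
  let ?P = "VCG_assignment n m t" and ?B = "\<Sum>i<n. \<Sum>j<m. \<bar>t i j\<bar>"
  note [intro!] = integrable_measure_pmf_finite finite_set_VCG_assignment[OF assms]
  have "\<bar>VCG n m t\<bar> \<le> measure_pmf.expectation ?P (\<lambda>a. \<bar>makespan n m t a\<bar>)"
    unfolding VCG_def by (rule integral_abs_bound)
  also have "\<dots> \<le> measure_pmf.expectation ?P (\<lambda>_. ?B)"
    by (intro integral_mono makespan_abs_le assms) auto
  finally show ?thesis by simp
qed

text \<open>
  The bound \<open>s * max \<le> ln (\<Sum> exp (s * load))\<close> with the logarithm replaced by its tangent at \<open>C\<close>,
  so that expectations can be taken on the right without Jensen's inequality.
\<close>

lemma VCG_exp_bound:
  assumes "1 \<le> n" "0 < s" "0 < C"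
  shows "VCG n m t \<le> (ln C - 1 + (\<Sum>i<n. \<Prod>j<m. 1 + share n (\<lambda>i. t i j) i *
           (exp (s * min_entry n (\<lambda>i. t i j)) - 1)) / C) / s"
proof -
  let ?P = "VCG_assignment n m t"
  define load where "load a i = (\<Sum>j\<in>{j. j < m \<and> a j = i}. t i j)" for a i
  note [intro!] = integrable_measure_pmf_finite finite_set_VCG_assignment[OF assms(1)]
  have pt: "makespan n m t a \<le> (ln C - 1 + (\<Sum>i<n. exp (s * load a i)) / C) / s" for a
  proof -
    have "makespan n m t a \<in> load a ` {..<n}"
      unfolding makespan_def load_def using assms by (intro Max_in) (auto simp: lessThan_empty_iff)
    then obtain k where k: "k < n" "makespan n m t a = load a k" by auto
    have "s * load a k - ln C = ln (exp (s * load a k) / C)"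
      using assms by (simp add: ln_div)
    also have "\<dots> \<le> exp (s * load a k) / C - 1" using assms by (intro ln_le_minus_one) auto
    also have "\<dots> \<le> (\<Sum>i<n. exp (s * load a i)) / C - 1"
      using assms k by (intro diff_right_mono divide_right_mono
          member_le_sum[of _ _ "\<lambda>i. exp (s * load a i)"]) auto
    finally show ?thesis using assms k by (simp add: field_simps)
  qed
  \<comment> \<open>Ties of different tasks are broken independently, so the expectation factorises
    over tasks. Task \<open>j\<close> contributes \<open>exp (s * t i j)\<close> if it goes to
    machine \<open>i\<close> and 1 otherwise.\<close>
  have ex: "measure_pmf.expectation ?P (\<lambda>a. exp (s * load a i))
      = (\<Prod>j<m. 1 + share n (\<lambda>i. t i j) i * (exp (s * min_entry n (\<lambda>i. t i j)) - 1))"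
    if i: "i < n" for i
  proof -
    have [simp]: "finite (set_pmf (pmf_of_set (fastest_machines n t j)))" for j
      using assms(1) by (simp add: fastest_machines_finite fastest_machines_nonempty)
    have "exp (s * load a i) = (\<Prod>j<m. if a j = i then exp (s * t i j) else 1)" for a
      by (simp add: load_def sum_distrib_left exp_sum prod.If_cases Int_def)
    then have "measure_pmf.expectation ?P (\<lambda>a. exp (s * load a i))
      = (\<Prod>j<m. measure_pmf.expectation (pmf_of_set (fastest_machines n t j))
            (\<lambda>k. if k = i then exp (s * t i j) else 1))"
      unfolding VCG_assignment_def
      by (simp only:) (rule expectation_prod_Pi_pmf,
        auto simp: fastest_machines_finite fastest_machines_nonempty assms(1)[simplified])
    also have "\<dots> = (\<Prod>j<m. 1 + share n (\<lambda>i. t i j) i * (exp (s * min_entry n (\<lambda>i. t i j)) - 1))"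
    proof (rule prod.cong[OF refl])
      fix j
      let ?F = "fastest_machines n t j"
      let ?p = "pmf_of_set ?F"
      have "measure_pmf.expectation ?p (\<lambda>k. if k = i then exp (s * t i j) else 1)
          = measure_pmf.expectation ?p (\<lambda>k. 1 + (exp (s * t i j) - 1) * indicator {i} k)"
        by (intro Bochner_Integration.integral_cong) auto
      also have "\<dots> = 1 + (exp (s * t i j) - 1) * pmf ?p i"
        by (subst Bochner_Integration.integral_add) (auto simp: measure_pmf_single)
      \<comment> \<open>The share vanishes unless \<open>t i j\<close> is the column minimum, so the
        minimum may be written in the exponent.\<close>
      also have "\<dots> = 1 + share n (\<lambda>i. t i j) i * (exp (s * min_entry n (\<lambda>i. t i j)) - 1)"
        using share_eq[OF i, of t j, symmetric] by (simp add: share_def mult.commute)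
      finally show "measure_pmf.expectation ?p (\<lambda>k. if k = i then exp (s * t i j) else 1)
          = 1 + share n (\<lambda>i. t i j) i * (exp (s * min_entry n (\<lambda>i. t i j)) - 1)" .
    qed
    finally show ?thesis .
  qed
  have "VCG n m t \<le> measure_pmf.expectation ?P (\<lambda>a. (ln C - 1 + (\<Sum>i<n. exp (s * load a i)) / C) / s)"
    unfolding VCG_def by (intro integral_mono pt) auto
  also have "\<dots> = (ln C - 1 + (\<Sum>i<n. measure_pmf.expectation ?P (\<lambda>a. exp (s * load a i))) / C) / s"
    by (subst integral_divide_zero, subst Bochner_Integration.integral_add, blast, blast,
        subst integral_divide_zero, subst Bochner_Integration.integral_sum) auto
  finally show ?thesis by (simp add: ex)
qed

section \<open>Independent processing times\<close>

lemma (in prob_space) prob_min_entry_gt: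
  fixes X :: "nat \<Rightarrow> nat \<Rightarrow> 'a \<Rightarrow> real"
  assumes n: "1 \<le> n"
    and indep: "indep_vars (\<lambda>_. borel) (\<lambda>(i, j). X i j) ({..<n} \<times> {..<m})"
    and distr: "\<And>i j. i < n \<Longrightarrow> j < m \<Longrightarrow> distr M borel (X i j) = D"
    and j: "j < m"
  shows "prob {\<omega> \<in> space M. x < min_entry n (\<lambda>i. X i j \<omega>)} = measure D {x<..} ^ n"
proof -
  have rv: "random_variable borel (X i j)" if "i < n" for i
    using indep that j by (auto simp: indep_vars_def2)
  have "{\<omega> \<in> space M. x < min_entry n (\<lambda>i. X i j \<omega>)}
      = (\<Inter>p\<in>{..<n} \<times> {j}. (case p of (i, j) \<Rightarrow> X i j) -` {x<..} \<inter> space M)"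
    using n by (auto simp: min_entry_def lessThan_empty_iff)
  also have "prob \<dots> = (\<Prod>p\<in>{..<n} \<times> {j}. prob ((case p of (i, j) \<Rightarrow> X i j) -` {x<..} \<inter> space M))"
    using n j by (intro indep_varsD[OF indep]) (auto simp: lessThan_empty_iff)
  also have "\<dots> = (\<Prod>p\<in>{..<n} \<times> {j}. measure D {x<..})"
  proof (rule prod.cong[OF refl])
    fix p assume "p \<in> {..<n} \<times> {j}"
    then obtain i where i: "p = (i, j)" "i < n" by auto
    show "prob ((case p of (i, j) \<Rightarrow> X i j) -` {x<..} \<inter> space M) = measure D {x<..}"
      using rv[OF i(2)] unfolding distr[OF i(2) j, symmetric] i(1) by (simp add: measure_distr)
  qed
  finally show ?thesis by (simp add: card_cartesian_product)
qed

text \<open>The joint law of an i.i.d. family is a power of \<open>D\<close>, which an injective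
  reindexing preserves. It is applied to column swaps, to equate the means of the minima, and to row
  swaps, to equate the machines.\<close>

lemma (in prob_space) expectation_iid_reindex:
  fixes X :: "'i \<Rightarrow> 'a \<Rightarrow> 'b" and \<phi> :: "('i \<Rightarrow> 'b) \<Rightarrow> real"
  assumes indep: "indep_vars (\<lambda>_. N) X I"
    and distr: "\<And>i. i \<in> I \<Longrightarrow> distr M N (X i) = D"
    and f: "inj_on f I" "f \<in> I \<rightarrow> I"
    and [measurable]: "\<phi> \<in> borel_measurable (Pi\<^sub>M I (\<lambda>_. N))"
  shows "expectation (\<lambda>\<omega>. \<phi> (\<lambda>i\<in>I. X (f i) \<omega>)) = expectation (\<lambda>\<omega>. \<phi> (\<lambda>i\<in>I. X i \<omega>))"
\<comment> \<open>For empty \<open>I\<close> the hypotheses say nothing about \<open>D\<close>, but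
  both sides then evaluate \<open>\<phi>\<close> at the same point.\<close>
proof (cases "I = {}")
  case False
  have rv: "random_variable N (X i)" if "i \<in> I" for i
    using indep that by (auto simp: indep_vars_def2)
  have D: "prob_space D" "sets D = sets N"
    using False distr prob_space_distr[OF rv] by (force, metis ex_in_conv sets_distr)
  have sets: "sets (Pi\<^sub>M I (\<lambda>_. D)) = sets (Pi\<^sub>M I (\<lambda>_. N))"
    using D by (intro sets_PiM_cong) auto
  have [measurable]: "(\<lambda>\<omega>. \<lambda>i\<in>I. X i \<omega>) \<in> measurable M (Pi\<^sub>M I (\<lambda>_. N))"
    using rv by (intro measurable_restrict) auto
  have meas_f [measurable]: "(\<lambda>x. \<lambda>i\<in>I. x (f i)) \<in> measurable (Pi\<^sub>M I (\<lambda>_. N)) (Pi\<^sub>M I (\<lambda>_. N))"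
    using f by (intro measurable_restrict measurable_component_singleton) auto
  have joint: "distr M (Pi\<^sub>M I (\<lambda>_. N)) (\<lambda>\<omega>. \<lambda>i\<in>I. X i \<omega>) = Pi\<^sub>M I (\<lambda>_. D)"
    using indep_vars_iff_distr_eq_PiM'[OF False rv] indep distr
    by (simp cong: PiM_cong)
  have "expectation (\<lambda>\<omega>. \<phi> (\<lambda>i\<in>I. X (f i) \<omega>))
      = expectation (\<lambda>\<omega>. \<phi> (\<lambda>i\<in>I. (\<lambda>i\<in>I. X i \<omega>) (f i)))"
    using f by (intro Bochner_Integration.integral_cong refl arg_cong[where f=\<phi>])
      (auto simp: Pi_iff intro!: restrict_ext)
  also have "\<dots> = (\<integral>x. \<phi> (\<lambda>i\<in>I. x (f i)) \<partial>Pi\<^sub>M I (\<lambda>_. D))"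
    unfolding joint[symmetric] by (rule integral_distr[symmetric]) measurable
  also have "\<dots> = (\<integral>x. \<phi> x \<partial>distr (Pi\<^sub>M I (\<lambda>_. D)) (Pi\<^sub>M I (\<lambda>_. D)) (\<lambda>x. \<lambda>i\<in>I. x (f i)))"
  proof (rule integral_distr[symmetric])
    show "(\<lambda>x. \<lambda>i\<in>I. x (f i)) \<in> measurable (Pi\<^sub>M I (\<lambda>_. D)) (Pi\<^sub>M I (\<lambda>_. D))"
      using meas_f by (simp only: measurable_cong_sets[OF sets sets])
    show "\<phi> \<in> borel_measurable (Pi\<^sub>M I (\<lambda>_. D))"
      using assms(5) by (simp only: measurable_cong_sets[OF sets refl])
  qed
  also have "\<dots> = (\<integral>x. \<phi> x \<partial>Pi\<^sub>M I (\<lambda>_. D))"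
    using f D by (subst distr_PiM_reindex) auto
  also have "\<dots> = expectation (\<lambda>\<omega>. \<phi> (\<lambda>i\<in>I. X i \<omega>))"
    unfolding joint[symmetric] by (rule integral_distr) measurable
  finally show ?thesis .
qed (simp add: restrict_def)

theorem theorem5:
  fixes M :: "'w measure" and D :: "real measure"
    and T :: "nat \<Rightarrow> nat \<Rightarrow> 'w \<Rightarrow> real" and n m :: nat
  assumes "n \<ge> 1" and "m \<ge> n"
    and "prob_space M"
    and "MHR D" and "AE x in D. 0 \<le> x"
    and "prob_space.indep_vars M (\<lambda>_. borel) (\<lambda>(i, j). T i j) ({..<n} \<times> {..<m})"
    and "\<And>i j. i < n \<Longrightarrow> j < m \<Longrightarrow> distr M borel (T i j) = D"
  shows "integrable M (\<lambda>\<omega>. VCG n m (\<lambda>i j. T i j \<omega>)) \<and>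
         integrable M (\<lambda>\<omega>. OPT n m (\<lambda>i j. T i j \<omega>)) \<and>
         prob_space.expectation M (\<lambda>\<omega>. VCG n m (\<lambda>i j. T i j \<omega>))
           \<le> 2 * (1 + real n * ln (real n) / real m)
               * prob_space.expectation M (\<lambda>\<omega>. OPT n m (\<lambda>i j. T i j \<omega>))"
proof -
  interpret prob_space M by fact
  define I where "I = {..<n} \<times> {..<m}"
  define X where "X = (\<lambda>(i, j). T i j)"
  have indep: "indep_vars (\<lambda>_. borel) X I" using assms(6) by (simp add: I_def X_def)
  have distr: "distr M borel (X p) = D" if "p \<in> I" for p
    using assms(7) that by (auto simp: I_def X_def)
  have rv: "random_variable borel (T i j)" if "i < n" "j < m" for i j
    using assms(6) that by (auto simp: indep_vars_def2)
  have m: "0 < m" using assms by simp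
  have D: "prob_space D" "sets D = sets borel"
    using assms(7)[of 0 0] prob_space_distr[OF rv[of 0 0]] m assms(1) by auto
  define Y where "Y j \<omega> = min_entry n (\<lambda>i. T i j \<omega>)" for j \<omega>
  define W where "W i j \<omega> = share n (\<lambda>i. T i j \<omega>) i" for i j \<omega>
  have Y_meas: "random_variable borel (Y j)" if "j < m" for j
    unfolding Y_def using that by (intro borel_measurable_min_entry rv)
  have W_meas: "random_variable borel (W i j)" if "i < n" "j < m" for i j
    unfolding W_def using that by (intro borel_measurable_share rv)

  \<comment> \<open>Integrability of VCG and OPT\<close>
  have T_distr_int: "integrable (distr M borel (T i j)) (\<lambda>x. x)" if "i < n" "j < m" for i j
    unfolding assms(7)[OF that] using D assms(4,5)
    by (intro NBU_exp_moment MHR_survival_0 MHR_survival_add_le)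
  \<comment> \<open>The processing times have a finite mean because the NBU moment lemma has just
    been applied to \<open>D\<close> itself.\<close>
  have T_int: "integrable M (T i j)" if "i < n" "j < m" for i j
    using integrable_distr[OF rv[OF that] T_distr_int[OF that]] .
  then have bound_int: "integrable M (\<lambda>\<omega>. \<Sum>i<n. \<Sum>j<m. \<bar>T i j \<omega>\<bar>)"
    by (intro Bochner_Integration.integrable_sum integrable_abs) auto
  have makespan_meas: "random_variable borel (\<lambda>\<omega>. makespan n m (\<lambda>i j. T i j \<omega>) a)" for a
    unfolding makespan_def using rv by (intro borel_measurable_Max borel_measurable_sum) auto
  have VCG_int: "integrable M (\<lambda>\<omega>. VCG n m (\<lambda>i j. T i j \<omega>))"
  proof (rule Bochner_Integration.integrable_bound[OF bound_int])
    show "random_variable borel (\<lambda>\<omega>. VCG n m (\<lambda>i j. T i j \<omega>))"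
      unfolding VCG_eq_sum[OF assms(1)] using W_meas[unfolded W_def]
      by (intro borel_measurable_sum borel_measurable_times borel_measurable_prod makespan_meas)
        (auto simp: PiE_iff)
  qed (use VCG_abs_le[OF assms(1)] in \<open>auto intro: order_trans[OF _ abs_ge_self]\<close>)
  have OPT_int: "integrable M (\<lambda>\<omega>. OPT n m (\<lambda>i j. T i j \<omega>))"
  proof (rule Bochner_Integration.integrable_bound[OF bound_int])
    show "random_variable borel (\<lambda>\<omega>. OPT n m (\<lambda>i j. T i j \<omega>))"
      unfolding OPT_def by (intro borel_measurable_Min makespan_meas) (auto intro!: finite_PiE)
  qed (use OPT_abs_le[OF assms(1)] in \<open>auto intro: order_trans[OF _ abs_ge_self]\<close>)

  \<comment> \<open>Mean and exponential moments of the column minima\<close>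
  define \<mu> where "\<mu> = expectation (Y 0)"
  have entry_meas: "(\<lambda>x. x (i, j)) \<in> borel_measurable (Pi\<^sub>M I (\<lambda>_. borel))" if "i < n" "j < m" for i j
    using that by (intro measurable_component_singleton) (auto simp: I_def)
  have Y_mean: "expectation (Y j) = \<mu>" if "j < m" for j
  proof -
    let ?\<phi> = "\<lambda>x. min_entry n (\<lambda>i. x (i, 0::nat))"
    let ?f = "\<lambda>(i, j'). (i::nat, Transposition.transpose 0 j j')"
    have "expectation (\<lambda>\<omega>. ?\<phi> (\<lambda>p\<in>I. X (?f p) \<omega>)) = expectation (\<lambda>\<omega>. ?\<phi> (\<lambda>p\<in>I. X p \<omega>))"
    proof (rule expectation_iid_reindex[OF indep distr])
      show "inj_on ?f I" by (auto simp: inj_on_def dest: injD[OF inj_transpose])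
      show "?f \<in> I \<rightarrow> I" using that m by (auto simp: I_def Transposition.transpose_def)
      show "?\<phi> \<in> borel_measurable (Pi\<^sub>M I (\<lambda>_. borel))"
        using m by (intro borel_measurable_min_entry entry_meas)
    qed
    moreover have "?\<phi> (\<lambda>p\<in>I. X (?f p) \<omega>) = Y j \<omega>" "?\<phi> (\<lambda>p\<in>I. X p \<omega>) = Y 0 \<omega>" for \<omega>
      unfolding Y_def using m by (auto simp: I_def X_def intro!: min_entry_cong)
    ultimately show ?thesis by (simp add: \<mu>_def)
  qed

  have law: "prob_space (distr M borel (Y j))"
    "measure (distr M borel (Y j)) {x<..} = measure D {x<..} ^ n" if "j < m" for j x
  proof -
    show "prob_space (distr M borel (Y j))" using Y_meas[OF that] by (rule prob_space_distr)
    have "Y j -` {x<..} \<inter> space M = {\<omega> \<in> space M. x < min_entry n (\<lambda>i. T i j \<omega>)}"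
      by (auto simp: Y_def)
    then show "measure (distr M borel (Y j)) {x<..} = measure D {x<..} ^ n"
      using Y_meas[OF that] prob_min_entry_gt[OF assms(1,6,7) that] by (simp add: measure_distr)
  qed
  have Y_moments: "integrable M (Y j)" "0 < \<mu>" "integrable M (\<lambda>\<omega>. exp (Y j \<omega> / (2 * \<mu>)))"
    "expectation (\<lambda>\<omega>. exp (Y j \<omega> / (2 * \<mu>))) \<le> 2" if j: "j < m" for j
  proof -
    let ?N = "distr M borel (Y j)"
    have 0: "measure ?N {0<..} = 1"
      using MHR_survival_0[OF D(1) assms(4,5)] by (simp add: law[OF j])
    have nbu: "measure ?N {x + y<..} \<le> measure ?N {x<..} * measure ?N {y<..}" if "0 \<le> x" "0 \<le> y" for x y
      unfolding law[OF j] power_mult_distrib[symmetric]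
      by (intro power_mono MHR_survival_add_le D assms that) auto
    have mean: "(\<integral>x. x \<partial>?N) = \<mu>"
      using Y_meas[OF j] Y_mean[OF j] by (simp add: integral_distr)
    note moments = NBU_exp_moment[OF law(1)[OF j] sets_distr 0 nbu, unfolded mean]
    show "integrable M (Y j)" "0 < \<mu>" "integrable M (\<lambda>\<omega>. exp (Y j \<omega> / (2 * \<mu>)))"
      "expectation (\<lambda>\<omega>. exp (Y j \<omega> / (2 * \<mu>))) \<le> 2"
      using moments Y_meas[OF j] by (simp_all add: integrable_distr_eq integral_distr)
  qed
  note \<mu>_pos = Y_moments(2)[OF m]

  \<comment> \<open>Exponential moments of the machine loads\<close>
  define s where "s = 1 / (2 * \<mu>)"
  have s: "0 < s" "\<And>y. s * y = y / (2 * \<mu>)" using \<mu>_pos by (auto simp: s_def)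
  \<comment> \<open>Given the processing times, \<open>1 + Z i j\<close> is the tie-breaking average
    of the factor that task \<open>j\<close> contributes to the exponential of the load of machine
    \<open>i\<close>.\<close>
  define Z where "Z i j \<omega> = W i j \<omega> * (exp (s * Y j \<omega>) - 1)" for i j \<omega>
  have Z_int: "integrable M (Z i j)" if "i < n" "j < m" for i j
  proof -
    have "integrable M (\<lambda>\<omega>. exp (s * Y j \<omega>) + 1)"
      using Y_moments(3)[OF that(2)] by (simp add: s(2))
    then show ?thesis
    proof (rule Bochner_Integration.integrable_bound)
      show "random_variable borel (Z i j)"
        unfolding Z_def using W_meas[OF that] Y_meas[OF that(2)] by measurable
      have "\<bar>exp (s * Y j \<omega>) - 1\<bar> \<le> exp (s * Y j \<omega>) + 1" for \<omega>
        using exp_gt_zero[of "s * Y j \<omega>"] by linarith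
      then have "norm (Z i j \<omega>) \<le> 1 * (exp (s * Y j \<omega>) + 1)" for \<omega>
        unfolding Z_def real_norm_def abs_mult W_def
        using share_nonneg share_le_1[OF that(1)] by (intro mult_mono) auto
      then show "AE \<omega> in M. norm (Z i j \<omega>) \<le> norm (exp (s * Y j \<omega>) + 1)" by simp
    qed
  qed
  \<comment> \<open>Swapping rows \<open>i\<close> and \<open>k\<close> preserves the joint law. The equal splitting of ties in
    \<open>share\<close> makes this exact, so ties need not be shown to be null.\<close>
  have Z_sym: "expectation (Z i j) = expectation (Z k j)" if "i < n" "k < n" "j < m" for i j k
  proof -
    let ?\<phi> = "\<lambda>x. share n (\<lambda>i. x (i, j)) k * (exp (s * min_entry n (\<lambda>i. x (i, j))) - 1)"
    let ?p = "Transposition.transpose i k"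
    let ?f = "\<lambda>(i', j'). (?p i', j' :: nat)"
    have p: "bij_betw ?p {..<n} {..<n}"
      using that by simp
    have pn: "?p i' < n" if "i' < n" for i'
      using bij_betwE[OF p] that by auto
    have "expectation (\<lambda>\<omega>. ?\<phi> (\<lambda>p\<in>I. X (?f p) \<omega>)) = expectation (\<lambda>\<omega>. ?\<phi> (\<lambda>p\<in>I. X p \<omega>))"
    proof (rule expectation_iid_reindex[OF indep distr])
      show "inj_on ?f I" by (auto simp: inj_on_def dest: injD[OF inj_transpose])
      show "?f \<in> I \<rightarrow> I" using pn by (auto simp: I_def)
      show "?\<phi> \<in> borel_measurable (Pi\<^sub>M I (\<lambda>_. borel))"
        using that by (intro borel_measurable_times borel_measurable_diff borel_measurable_exp
            borel_measurable_const borel_measurable_min_entry borel_measurable_share entry_meas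
            measurable_compose[OF _ borel_measurable_exp])
    qed
    moreover have "?\<phi> (\<lambda>p\<in>I. X p \<omega>) = Z k j \<omega>" for \<omega>
      unfolding Z_def W_def Y_def using that
      by (auto simp: I_def X_def intro!: arg_cong2[where f="\<lambda>x y. x * (exp (s * y) - 1)"]
          min_entry_cong share_cong)
    moreover have "?\<phi> (\<lambda>p\<in>I. X (?f p) \<omega>) = Z i j \<omega>" for \<omega>
    proof -
      have "?\<phi> (\<lambda>p\<in>I. X (?f p) \<omega>)
          = share n (\<lambda>i'. T (?p i') j \<omega>) k * (exp (s * min_entry n (\<lambda>i'. T (?p i') j \<omega>)) - 1)"
        using that by (auto simp: I_def X_def
            intro!: arg_cong2[where f="\<lambda>x y. x * (exp (s * y) - 1)"] min_entry_cong share_cong)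
      also have "\<dots> = Z i j \<omega>"
        using share_permute[OF p, of "\<lambda>i. T i j \<omega>" k] min_entry_permute[OF p, of "\<lambda>i. T i j \<omega>"]
        by (simp add: Z_def W_def Y_def)
      finally show ?thesis .
    qed
    ultimately show ?thesis by simp
  qed
  \<comment> \<open>The shares of a task sum to 1, so the \<open>Z k j\<close> sum over
    \<open>k\<close> to \<open>exp (s * Y j) - 1\<close>, whose mean is at most 1. By symmetry each
    machine carries one \<open>n\<close>-th of it.\<close>
  have Z_le: "expectation (Z i j) \<le> 1 / real n" if "i < n" "j < m" for i j
  proof -
    have "real n * expectation (Z i j) = (\<Sum>k<n. expectation (Z k j))"
      using Z_sym[OF _ that(1) that(2)] by simp
    also have "\<dots> = expectation (\<lambda>\<omega>. \<Sum>k<n. Z k j \<omega>)"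
      using Z_int that by (subst Bochner_Integration.integral_sum) auto
    also have "\<dots> = expectation (\<lambda>\<omega>. exp (s * Y j \<omega>) - 1)"
      by (simp add: Z_def W_def sum_share assms(1)[simplified] flip: sum_distrib_right)
    also have "\<dots> = expectation (\<lambda>\<omega>. exp (s * Y j \<omega>)) - 1"
      using Y_moments(3)[OF that(2)] by (subst Bochner_Integration.integral_diff) (auto simp: s(2) prob_space)
    also have "\<dots> \<le> 1" using Y_moments(4)[OF that(2)] by (simp add: s(2))
    finally show ?thesis using assms(1) by (simp add: field_simps)
  qed
  \<comment> \<open>A convex combination of 1 and an exponential, hence nonnegative at every point,
    even where \<open>Y j\<close> is negative. The product of expectations can then be bounded
    factor by factor.\<close>
  have Z_ge: "0 \<le> 1 + Z i j \<omega>" if "i < n" for i j \<omega>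
  proof -
    have "1 + Z i j \<omega> = (1 - W i j \<omega>) + W i j \<omega> * exp (s * Y j \<omega>)"
      by (simp add: Z_def algebra_simps)
    also have "0 \<le> \<dots>"
      using share_nonneg share_le_1[OF that] by (simp add: W_def add_nonneg_nonneg del: diff_add_eq)
    finally show ?thesis .
  qed
  \<comment> \<open>Each factor is a function of one column of the matrix, and disjoint columns are
    independent blocks.\<close>
  have Z_indep: "indep_vars (\<lambda>_. borel) (\<lambda>j \<omega>. 1 + Z i j \<omega>) {..<m}" if "i < n" for i
  proof -
    let ?K = "\<lambda>j. {..<n} \<times> {j}"
    let ?g = "\<lambda>j x. 1 + share n (\<lambda>i. x (i, j)) i * (exp (s * min_entry n (\<lambda>i. x (i, j))) - 1)"
    have "indep_vars (\<lambda>j. Pi\<^sub>M (?K j) (\<lambda>_. borel)) (\<lambda>j \<omega>. restrict (\<lambda>p. X p \<omega>) (?K j)) {..<m}"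
      by (intro indep_vars_restrict[OF indep]) (auto simp: I_def disjoint_family_on_def)
    then have "indep_vars (\<lambda>_. borel) (\<lambda>j \<omega>. ?g j (restrict (\<lambda>p. X p \<omega>) (?K j))) {..<m}"
    proof (rule indep_vars_compose2)
      fix j
      have "(\<lambda>x. x (i, j)) \<in> borel_measurable (Pi\<^sub>M (?K j) (\<lambda>_. borel))" if "i < n" for i
        using that by (intro measurable_component_singleton) auto
      then show "?g j \<in> borel_measurable (Pi\<^sub>M (?K j) (\<lambda>_. borel))"
        using that by (intro borel_measurable_add borel_measurable_times borel_measurable_diff
            borel_measurable_const borel_measurable_min_entry borel_measurable_share
            measurable_compose[OF _ borel_measurable_exp])
    qed
    moreover have "?g j (restrict (\<lambda>p. X p \<omega>) (?K j)) = 1 + Z i j \<omega>" for j \<omega>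
      unfolding Z_def W_def Y_def using that
      by (auto simp: X_def intro!: arg_cong2[where f="\<lambda>x y. x * (exp (s * y) - 1)"]
          min_entry_cong share_cong)
    ultimately show ?thesis by simp
  qed
  have prod: "integrable M (\<lambda>\<omega>. \<Prod>j<m. 1 + Z i j \<omega>)"
    "expectation (\<lambda>\<omega>. \<Prod>j<m. 1 + Z i j \<omega>) \<le> exp (real m / real n)" if "i < n" for i
  proof -
    have int: "integrable M (\<lambda>\<omega>. 1 + Z i j \<omega>)" if "j \<in> {..<m}" for j
      using Z_int[OF \<open>i < n\<close>] that by auto
    show "integrable M (\<lambda>\<omega>. \<Prod>j<m. 1 + Z i j \<omega>)"
      using indep_vars_integrable[OF _ Z_indep[OF that] int] by simp
    have "expectation (\<lambda>\<omega>. \<Prod>j<m. 1 + Z i j \<omega>) = (\<Prod>j<m. expectation (\<lambda>\<omega>. 1 + Z i j \<omega>))"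
      using indep_vars_lebesgue_integral[OF _ Z_indep[OF that] int] by simp
    also have "\<dots> \<le> (\<Prod>j<m. exp (1 / real n))"
    proof (rule prod_mono)
      fix j assume j: "j \<in> {..<m}"
      have "expectation (\<lambda>\<omega>. 1 + Z i j \<omega>) = 1 + expectation (Z i j)"
        using Z_int[OF that, of j] j by (subst Bochner_Integration.integral_add) (auto simp: prob_space)
      also have "\<dots> \<le> exp (1 / real n)"
        using Z_le[OF that, of j] j exp_ge_add_one_self[of "1 / real n"] unfolding lessThan_iff by linarith
      finally show "0 \<le> expectation (\<lambda>\<omega>. 1 + Z i j \<omega>) \<and> expectation (\<lambda>\<omega>. 1 + Z i j \<omega>) \<le> exp (1 / real n)"
        using Z_ge[OF that] by (auto intro!: Bochner_Integration.integral_nonneg)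
    qed
    also have "\<dots> = exp (real m / real n)" by (simp flip: exp_of_nat_mult)
    finally show "expectation (\<lambda>\<omega>. \<Prod>j<m. 1 + Z i j \<omega>) \<le> exp (real m / real n)" .
  qed

  \<comment> \<open>Combining the estimates\<close>
  define C where "C = real n * exp (real m / real n)"
  \<comment> \<open>\<open>C\<close> is \<open>n\<close> times the bound on each expected product.
    The tangent is thus taken at the bound for the whole sum, so the terms beyond
    \<open>ln C\<close> are at most \<open>- 1 + 1 = 0\<close> in expectation and
    \<open>ln C / s\<close> remains.\<close>
  have C: "0 < C" "ln C = ln (real n) + real m / real n"
    using assms(1) by (auto simp: C_def ln_mult)
  let ?R = "\<lambda>\<omega>. (ln C - 1 + (\<Sum>i<n. \<Prod>j<m. 1 + Z i j \<omega>) / C) / s"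
  have sum_int: "integrable M (\<lambda>\<omega>. \<Sum>i<n. \<Prod>j<m. 1 + Z i j \<omega>)"
    by (intro Bochner_Integration.integrable_sum prod(1)) simp
  have "expectation (\<lambda>\<omega>. VCG n m (\<lambda>i j. T i j \<omega>)) \<le> expectation ?R"
  proof (rule integral_mono[OF VCG_int])
    show "integrable M ?R" using sum_int
      by (intro integrable_divide_zero Bochner_Integration.integrable_add) auto
    show "VCG n m (\<lambda>i j. T i j \<omega>) \<le> ?R \<omega>" for \<omega>
      using VCG_exp_bound[OF assms(1) s(1) C(1), of m "\<lambda>i j. T i j \<omega>"]
      by (simp add: Z_def W_def Y_def)
  qed
  also have "expectation ?R = (ln C - 1 + (\<Sum>i<n. expectation (\<lambda>\<omega>. \<Prod>j<m. 1 + Z i j \<omega>)) / C) / s"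
    using sum_int by (simp add: prob_space prod(1) Bochner_Integration.integral_sum)
  also have "\<dots> \<le> (ln C - 1 + (\<Sum>i<n. exp (real m / real n)) / C) / s"
    using prod(2) C s by (intro divide_right_mono add_left_mono sum_mono) auto
  also have "\<dots> = 2 * \<mu> * (ln (real n) + real m / real n)"
    using C assms(1) by (simp add: s_def) (simp add: C_def)
  finally have VCG_le: "expectation (\<lambda>\<omega>. VCG n m (\<lambda>i j. T i j \<omega>))
      \<le> 2 * \<mu> * (ln (real n) + real m / real n)" .

  have "real m * \<mu> = expectation (\<lambda>\<omega>. \<Sum>j<m. Y j \<omega>)"
    using Y_mean Y_moments(1) by (subst Bochner_Integration.integral_sum) auto
  also have "\<dots> \<le> expectation (\<lambda>\<omega>. real n * OPT n m (\<lambda>i j. T i j \<omega>))"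
    unfolding Y_def using Y_moments(1)[unfolded Y_def] OPT_int OPT_ge[OF assms(1)]
    by (intro integral_mono) auto
  finally have "\<mu> \<le> real n / real m * expectation (\<lambda>\<omega>. OPT n m (\<lambda>i j. T i j \<omega>))"
    using m by (simp add: field_simps)
  then have "2 * \<mu> * (ln (real n) + real m / real n)
      \<le> 2 * (real n / real m * expectation (\<lambda>\<omega>. OPT n m (\<lambda>i j. T i j \<omega>))) * (ln (real n) + real m / real n)"
    using assms(1) by (intro mult_right_mono) auto
  also have "\<dots> = 2 * (1 + real n * ln (real n) / real m) * expectation (\<lambda>\<omega>. OPT n m (\<lambda>i j. T i j \<omega>))"
    using assms(1) m by (simp add: field_simps)
  finally show ?thesis using VCG_int OPT_int VCG_le by linarith
qed

end
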